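(* For any given fair division instance $\widetilde{\mathcal{I}}=\langle [n],[m],\{\widetilde{v}_i\}_{i=1}^n \rangle$ with range parameter $1$, one can compute a $\frac{5}{6}$-PMMS allocation in polynomial time.
   Context: A fair division instance $\langle [n],[m],\{\widetilde v_i\}_{i=1}^n\rangle$ consists of agents $[n]=\{1,\dots,n\}$, indivisible goods $[m]=\{1,\dots,m\}$, and additive valuations $\widetilde v_i:2^{[m]}\to\mathbb{R}_{\ge 0}$, i.e. $\widetilde v_i(S)=\sum_{g\in S}\widetilde v_i(g)$. Throughout, every agent positively values at least one good, and every good has positive value for at least one agent. For a good $g$, $\gamma_g=\frac{\min_{j:\widetilde v_j(g)>0}\widetilde v_j(g)}{\max_i \widetilde v_i(g)}$; the range parameter of the instance is $\gamma=\min_{g\in[m]}\gamma_g$. (Range parameter $1$ means that for each good $g$ all agents with nonzero value for $g$ have the same value for it, i.e. valuations are restricted additive.) An allocation $\mathcal{A}=(A_1,\dots,A_n)$ is a tuple of pairwise disjoint subsets of $[m]$ with $\bigcup_i A_i=[m]$. For an agent $i$ and $S\subseteq[m]$, the 1-out-of-2 maximin share is $\widetilde\mu_i^{(2)}(S)=\max_{Y\subseteq S}\min\{\widetilde v_i(Y),\widetilde v_i(S\setminus Y)\}$. For $\alpha\in(0,1)$, $\mathcal{A}$ is $\alpha$-PMMS if $\widetilde v_i(A_i)\ge\alpha\,\widetilde\mu_i^{(2)}(A_i\cup A_j)$ for every pair of agents $i\ne j$. *)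

theory Defs
  imports Complex_Main "HOL-Computational_Algebra.Polynomial"
begin

section \<open>Fair division instances\<close>

text \<open>
  Agents are \<open>{..<n}\<close> and goods are \<open>{..<m}\<close>. A valuation is given by its values
  on single goods, and \<open>bundle_value\<close> is its additive extension.
\<close>

type_synonym valuations = "nat \<Rightarrow> nat \<Rightarrow> real"

definition bundle_value :: "valuations \<Rightarrow> nat \<Rightarrow> nat set \<Rightarrow> real" where
  "bundle_value v i S = (\<Sum>g\<in>S. v i g)"

definition fair_division_instance :: "nat \<Rightarrow> nat \<Rightarrow> valuations \<Rightarrow> bool" where
  "fair_division_instance n m v \<longleftrightarrow>
     n \<ge> 1 \<and>
     (\<forall>i<n. \<forall>g<m. v i g \<ge> 0) \<and>
     (\<forall>i<n. \<exists>g<m. v i g > 0) \<and>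
     (\<forall>g<m. \<exists>i<n. v i g > 0)"

definition good_range :: "nat \<Rightarrow> valuations \<Rightarrow> nat \<Rightarrow> real" where
  "good_range n v g = Min {v j g |j. j < n \<and> v j g > 0} / Max {v i g |i. i < n}"

definition range_parameter :: "nat \<Rightarrow> nat \<Rightarrow> valuations \<Rightarrow> real" where
  "range_parameter n m v = Min {good_range n v g |g. g < m}"

definition is_allocation :: "nat \<Rightarrow> nat \<Rightarrow> (nat \<Rightarrow> nat set) \<Rightarrow> bool" where
  "is_allocation n m A \<longleftrightarrow>
     (\<forall>i<n. \<forall>j<n. i \<noteq> j \<longrightarrow> A i \<inter> A j = {}) \<and> (\<Union>i<n. A i) = {..<m}"

definition maximin_share2 :: "valuations \<Rightarrow> nat \<Rightarrow> nat set \<Rightarrow> real" where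
  "maximin_share2 v i S =
     Max {min (bundle_value v i Y) (bundle_value v i (S - Y)) |Y. Y \<subseteq> S}"

definition is_PMMS :: "real \<Rightarrow> nat \<Rightarrow> valuations \<Rightarrow> (nat \<Rightarrow> nat set) \<Rightarrow> bool" where
  "is_PMMS \<alpha> n v A \<longleftrightarrow>
     (\<forall>i<n. \<forall>j<n. i \<noteq> j \<longrightarrow>
        bundle_value v i (A i) \<ge> \<alpha> * maximin_share2 v i (A i \<union> A j))"

section \<open>Model of computation\<close>

text \<open>
  Programs are imperative programs over arrays, in the style of a random access
  machine with real registers. Every identifier names an array, and a scalar is
  cell 0 of an array. There are two sorts of memory: \<open>imem\<close> holds natural numbers
  (indices and counters), and \<open>rmem\<close> holds real numbers.

  Every elementary command and every evaluation of a guard takes one unit of time.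
  The following restrictions keep this measure honest:
  reals can only be added, subtracted and compared; there is no multiplication
  and no conversion from reals to indices (such as rounding), and the constants
  in a program are integers. Theorem \<open>exec_growth\<close> below makes this precise: on
  inputs with common denominator \<open>D\<close>, all numbers in memory keep that denominator
  and their magnitude grows at most by a factor, fixed by the program, in each
  time unit. So on rational inputs, a run of polynomially many steps only handles
  numbers whose binary length is polynomial in that of the input, and can be
  simulated in polynomial time by a Turing machine.
\<close>

record state =
  imem :: "string \<Rightarrow> nat \<Rightarrow> nat"
  rmem :: "string \<Rightarrow> nat \<Rightarrow> real"

datatype iexp = IConst nat | ICell string iexp | IAdd iexp iexp | ISub iexp iexp

datatype rexp = RConst int | RCell string iexp | RAdd rexp rexp | RSub rexp rexp

datatype bexp = ILess iexp iexp | RLess rexp rexp | BNot bexp | BAnd bexp bexp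

datatype com =
    Skip
  | IAssign string iexp iexp
  | RAssign string iexp rexp
  | Seq com com
  | Cond bexp com com
  | While bexp com

primrec ival :: "iexp \<Rightarrow> state \<Rightarrow> nat" where
  "ival (IConst k) s = k"
| "ival (ICell x e) s = imem s x (ival e s)"
| "ival (IAdd a b) s = ival a s + ival b s"
| "ival (ISub a b) s = ival a s - ival b s"

primrec rval :: "rexp \<Rightarrow> state \<Rightarrow> real" where
  "rval (RConst z) s = real_of_int z"
| "rval (RCell x e) s = rmem s x (ival e s)"
| "rval (RAdd a b) s = rval a s + rval b s"
| "rval (RSub a b) s = rval a s - rval b s"

primrec bval :: "bexp \<Rightarrow> state \<Rightarrow> bool" where
  "bval (ILess a b) s \<longleftrightarrow> ival a s < ival b s"
| "bval (RLess a b) s \<longleftrightarrow> rval a s < rval b s"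
| "bval (BNot b) s \<longleftrightarrow> \<not> bval b s"
| "bval (BAnd a b) s \<longleftrightarrow> bval a s \<and> bval b s"

definition iwrite :: "string \<Rightarrow> nat \<Rightarrow> nat \<Rightarrow> state \<Rightarrow> state" where
  "iwrite x k y s = s\<lparr>imem := (imem s)(x := (imem s x)(k := y))\<rparr>"

definition rwrite :: "string \<Rightarrow> nat \<Rightarrow> real \<Rightarrow> state \<Rightarrow> state" where
  "rwrite x k y s = s\<lparr>rmem := (rmem s)(x := (rmem s x)(k := y))\<rparr>"

text \<open>
  \<open>exec c s t s'\<close>: started in \<open>s\<close>, the program \<open>c\<close> halts in \<open>s'\<close> after \<open>t\<close> time units.
\<close>

inductive exec :: "com \<Rightarrow> state \<Rightarrow> nat \<Rightarrow> state \<Rightarrow> bool" where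
  Skip: "exec Skip s 1 s"
| IAssign: "exec (IAssign x a e) s 1 (iwrite x (ival a s) (ival e s) s)"
| RAssign: "exec (RAssign x a e) s 1 (rwrite x (ival a s) (rval e s) s)"
| Seq: "exec c s t s' \<Longrightarrow> exec d s' t' s'' \<Longrightarrow> exec (Seq c d) s (t + t') s''"
| CondT: "bval b s \<Longrightarrow> exec c s t s' \<Longrightarrow> exec (Cond b c d) s (1 + t) s'"
| CondF: "\<not> bval b s \<Longrightarrow> exec d s t s' \<Longrightarrow> exec (Cond b c d) s (1 + t) s'"
| WhileF: "\<not> bval b s \<Longrightarrow> exec (While b c) s 1 s"
| WhileT: "bval b s \<Longrightarrow> exec c s t s' \<Longrightarrow> exec (While b c) s' t' s'' \<Longrightarrow>
             exec (While b c) s (1 + t + t') s''"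

inductive_cases SkipE: "exec Skip s t s'"
  and IAssignE: "exec (IAssign x a e) s t s'"
  and RAssignE: "exec (RAssign x a e) s t s'"
  and SeqE: "exec (Seq c d) s t s'"
  and CondE: "exec (Cond b c d) s t s'"
  and WhileE: "exec (While b c) s t s'"

theorem exec_deterministic:
  "exec c s t s' \<Longrightarrow> exec c s u s'' \<Longrightarrow> u = t \<and> s'' = s'"
proof (induction arbitrary: u s'' rule: exec.induct)
  case (Skip s)
  then show ?case by (rule SkipE) simp
next
  case (IAssign x a e s)
  then show ?case by (rule IAssignE) simp
next
  case (RAssign x a e s)
  then show ?case by (rule RAssignE) simp
next
  case (Seq c s t s' d t' s2)
  from Seq.prems show ?case by (rule SeqE) (metis Seq.IH)
next
  case (CondT b s c t s' d)
  from CondT.prems show ?case by (rule CondE) (metis CondT.hyps CondT.IH plus_1_eq_Suc)+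
next
  case (CondF b s d t s' c)
  from CondF.prems show ?case by (rule CondE) (metis CondF.hyps CondF.IH plus_1_eq_Suc)+
next
  case (WhileF b s c)
  from WhileF.prems show ?case by (rule WhileE) (use WhileF.hyps in simp_all)
next
  case (WhileT b s c t s' t' s2)
  from WhileT.prems show ?case by (rule WhileE) (metis WhileT.hyps WhileT.IH plus_1_eq_Suc add_Suc)+
qed

subsection \<open>Growth of numbers\<close>

primrec iweight :: "iexp \<Rightarrow> nat" where
  "iweight (IConst k) = max 1 k"
| "iweight (ICell x e) = 1"
| "iweight (IAdd a b) = iweight a + iweight b"
| "iweight (ISub a b) = iweight a + iweight b"

primrec rweight :: "rexp \<Rightarrow> nat" where
  "rweight (RConst z) = max 1 (nat \<bar>z\<bar>)"
| "rweight (RCell x e) = 1"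
| "rweight (RAdd a b) = rweight a + rweight b"
| "rweight (RSub a b) = rweight a + rweight b"

primrec weight :: "com \<Rightarrow> nat" where
  "weight Skip = 1"
| "weight (IAssign x a e) = iweight e"
| "weight (RAssign x a e) = rweight e"
| "weight (Seq c d) = max (weight c) (weight d)"
| "weight (Cond b c d) = max (weight c) (weight d)"
| "weight (While b c) = weight c"

definition bounded_memory :: "nat \<Rightarrow> real \<Rightarrow> state \<Rightarrow> bool" where
  "bounded_memory D B s \<longleftrightarrow>
     (\<forall>x k. real (imem s x k) \<le> B) \<and>
     (\<forall>x k. \<bar>rmem s x k\<bar> \<le> B \<and> real D * rmem s x k \<in> \<int>)"

lemma ival_bound:
  assumes "bounded_memory D B s" "B \<ge> 1"
  shows "real (ival e s) \<le> real (iweight e) * B"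
proof (induction e)
  case (IConst k)
  have "real k * 1 \<le> real (max 1 k) * B" by (rule mult_mono) (use assms in auto)
  then show ?case by simp
qed (use assms in \<open>auto simp: bounded_memory_def algebra_simps\<close>)

lemma rval_bound:
  assumes "bounded_memory D B s" "B \<ge> 1"
  shows "\<bar>rval e s\<bar> \<le> real (rweight e) * B \<and> real D * rval e s \<in> \<int>"
proof (induction e)
  case (RConst z)
  have "\<bar>real_of_int z\<bar> * 1 \<le> real (max 1 (nat \<bar>z\<bar>)) * B"
    by (rule mult_mono) (use assms in auto)
  then show ?case by simp
qed (use assms in \<open>auto simp: bounded_memory_def algebra_simps\<close>)

lemma bounded_memory_mono: "bounded_memory D B s \<Longrightarrow> B \<le> B' \<Longrightarrow> bounded_memory D B' s"
  unfolding bounded_memory_def by (meson order_trans)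

lemma weight_ge_1: "weight c \<ge> 1"
proof -
  have "iweight e \<ge> 1" for e by (induction e) auto
  moreover have "rweight e \<ge> 1" for e by (induction e) auto
  ultimately show ?thesis by (induction c) (auto simp: le_max_iff_disj)
qed

lemma exec_growth_aux:
  assumes "exec c s t s'" "bounded_memory D B s" "B \<ge> 1" "weight c \<le> w" "w \<ge> 1"
  shows "bounded_memory D (B * real w ^ t) s'"
  using assms
proof (induction arbitrary: B rule: exec.induct)
  case (Skip s)
  then show ?case by (auto intro!: bounded_memory_mono[of D B])
next
  case (IAssign x a e s)
  have "bounded_memory D (B * w) s"
    by (rule bounded_memory_mono[OF IAssign(1)]) (use IAssign in auto)
  moreover have "real (ival e s) \<le> B * w"
  proof -
    have "real (iweight e) * B \<le> real w * B" using IAssign by (intro mult_right_mono) auto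
    then show ?thesis using ival_bound[OF IAssign(1,2), of e] by (simp add: mult.commute)
  qed
  ultimately show ?case by (auto simp: bounded_memory_def iwrite_def)
next
  case (RAssign x a e s)
  have "bounded_memory D (B * w) s"
    by (rule bounded_memory_mono[OF RAssign(1)]) (use RAssign in auto)
  moreover have "\<bar>rval e s\<bar> \<le> B * w"
  proof -
    have "real (rweight e) * B \<le> real w * B" using RAssign by (intro mult_right_mono) auto
    then show ?thesis using rval_bound[OF RAssign(1,2), of e] by (simp add: mult.commute)
  qed
  ultimately show ?case
    using rval_bound[OF RAssign(1,2), of e] by (auto simp: bounded_memory_def rwrite_def)
next
  case (Seq c s t s' d t' s'')
  have "1 * 1 \<le> B * real w ^ t" by (rule mult_mono) (use Seq.prems in auto)
  then have "bounded_memory D (B * real w ^ t * real w ^ t') s''"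
    using Seq by auto
  then show ?case by (simp add: power_add mult.assoc)
next
  case (CondT b s c t s' d)
  then have "bounded_memory D (B * real w ^ t) s'" by auto
  then show ?case by (rule bounded_memory_mono) (use CondT.prems in auto)
next
  case (CondF b s d t s' c)
  then have "bounded_memory D (B * real w ^ t) s'" by auto
  then show ?case by (rule bounded_memory_mono) (use CondF.prems in auto)
next
  case (WhileF b s c)
  then show ?case by (auto intro!: bounded_memory_mono[of D B])
next
  case (WhileT b s c t s' t' s'')
  have "1 * 1 \<le> B * real w ^ t" by (rule mult_mono) (use WhileT.prems in auto)
  then have "bounded_memory D (B * real w ^ t * real w ^ t') s''"
    using WhileT by auto
  then show ?case
    by (rule bounded_memory_mono) (use WhileT.prems in \<open>auto simp: power_add mult.assoc\<close>)
qed

theorem exec_growth: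
  assumes "exec c s t s'" "bounded_memory D B s" "B \<ge> 1"
  shows "bounded_memory D (B * real (weight c) ^ t) s'"
  using exec_growth_aux[OF assms order_refl weight_ge_1] .

subsection \<open>Input and output conventions\<close>

text \<open>
  The numbers of agents and goods are in cell 0 of \<open>n\<close> and \<open>m\<close>, and the valuation
  matrix is stored row by row in the array \<open>v\<close>. All other cells are 0, so that the
  initial state contains nothing but the instance. When the program halts, cell \<open>g\<close>
  of the array \<open>owner\<close> holds the agent who receives good \<open>g\<close>.
\<close>

definition input_state :: "nat \<Rightarrow> nat \<Rightarrow> valuations \<Rightarrow> state" where
  "input_state n m v =
     \<lparr>imem = (\<lambda>x k. if x = ''n'' \<and> k = 0 then n else if x = ''m'' \<and> k = 0 then m else 0),
      rmem = (\<lambda>x k. if x = ''v'' \<and> k < n * m then v (k div m) (k mod m) else 0)\<rparr>"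

definition output_allocation :: "nat \<Rightarrow> state \<Rightarrow> nat \<Rightarrow> nat set" where
  "output_allocation m s i = {g. g < m \<and> imem s ''owner'' g = i}"

end

theory Submission
  imports Defs
begin

text \<open>
  Process the goods by decreasing value and give each one to the poorest agent who values
  it. From the point of view of agent \<open>i\<close>, a good \<open>b\<close> goes to \<open>j\<close> only if at that moment the
  bundle of \<open>j\<close> is worth at most that of \<open>i\<close>, because \<open>j\<close> values all of its own goods and
  hence at least as much as \<open>i\<close> does. So the pair behaves like a run of the
  longest-processing-time rule on two machines, whose ratio for maximizing the smaller
  load is \<open>5/6\<close>: let \<open>b\<close> be the last good that \<open>j\<close> receives among those valued by \<open>i\<close>, and
  \<open>a\<close> the value of \<open>i\<close>'s final bundle. If \<open>b \<le> 2a/5\<close>, the average of the two bundles is at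
  most \<open>a + b/2 \<le> 6a/5\<close>. Otherwise at most five goods are worth at least \<open>b\<close>, and one side
  of any partition contains few enough of them to be worth at most \<open>6a/5\<close>.
\<close>

section \<open>Two-way partitions\<close>

text \<open>By symmetry take the side without \<open>x\<close>. If it holds all of
  \<open>L - {x}\<close>, the other side has only \<open>x\<close> and goods outside
  \<open>L\<close>. Otherwise it also misses some \<open>y\<close> in \<open>L\<close>, worth at
  least \<open>d\<close>.\<close>

lemma min_le_of_smallest_removed:
  fixes u :: "nat \<Rightarrow> real"
  assumes fin: "finite X" and nonneg: "\<And>g. g \<in> X \<Longrightarrow> 0 \<le> u g"
    and LX: "L \<subseteq> X" and Y: "Y \<subseteq> X"
    and x: "x \<in> L" "u x \<le> c"
    and big: "\<And>g. g \<in> L \<Longrightarrow> d \<le> u g"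
    and L: "sum u (L - {x}) - d \<le> c"
  shows "min (sum u Y) (sum u (X - Y)) \<le> c + sum u (X - L)"
proof -
  have *: "min (sum u Z) (sum u (X - Z)) \<le> c + sum u (X - L)"
    if Z: "Z \<subseteq> X" "x \<notin> Z" for Z
  proof (cases "L - {x} \<subseteq> Z")
    case True
    have "sum u (X - Z) \<le> sum u (insert x (X - L))"
      by (rule sum_mono2) (use True fin nonneg x LX in auto)
    also have "\<dots> = u x + sum u (X - L)" using fin x by simp
    finally show ?thesis using x by simp
  next
    case False
    then obtain y where y: "y \<in> L" "y \<noteq> x" "y \<notin> Z" by auto
    have finL: "finite L" using LX fin by (rule finite_subset)
    have "sum u Z \<le> sum u ((L - {x} - {y}) \<union> (X - L))"
      by (rule sum_mono2) (use Z fin finL nonneg y LX in auto)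
    also have "\<dots> = sum u (L - {x} - {y}) + sum u (X - L)"
      by (rule sum.union_disjoint) (use fin finL in auto)
    also have "sum u (L - {x} - {y}) = sum u (L - {x}) - u y"
      using y finL by (subst sum_diff1) auto
    finally show ?thesis using L big[of y] y by simp
  qed
  show ?thesis
  proof (cases "x \<in> Y")
    case False
    then show ?thesis using * Y by blast
  next
    case True
    have "X - (X - Y) = Y" using Y by auto
    then show ?thesis using *[of "X - Y"] True by (simp add: min.commute)
  qed
qed

text \<open>The two sides share at most five goods of \<open>L\<close>, so one of them holds at most
  two.\<close>

lemma min_le_of_five_large:
  fixes u :: "nat \<Rightarrow> real"
  assumes fin: "finite X" and nonneg: "\<And>g. g \<in> X \<Longrightarrow> 0 \<le> u g"
    and LX: "L \<subseteq> X" and Y: "Y \<subseteq> X"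
    and card: "card L \<le> 5" and c: "0 \<le> c" "\<And>g. g \<in> L \<Longrightarrow> u g \<le> c"
  shows "min (sum u Y) (sum u (X - Y)) \<le> 2 * c + sum u (X - L)"
proof -
  have finL: "finite L" using fin LX finite_subset by blast
  have *: "sum u Z \<le> 2 * c + sum u (X - L)" if Z: "Z \<subseteq> X" "card (Z \<inter> L) \<le> 2" for Z
  proof -
    have "sum u Z \<le> sum u ((Z \<inter> L) \<union> (X - L))"
      by (rule sum_mono2) (use Z fin finL nonneg LX in auto)
    also have "\<dots> = sum u (Z \<inter> L) + sum u (X - L)"
      by (rule sum.union_disjoint) (use fin finL in auto)
    also have "sum u (Z \<inter> L) \<le> real (card (Z \<inter> L)) * c"
      by (rule sum_bounded_above) (use c in auto)
    also have "\<dots> \<le> 2 * c" by (rule mult_right_mono) (use Z c in auto)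
    finally show ?thesis by simp
  qed
  have "card (Y \<inter> L) + card ((X - Y) \<inter> L) = card L"
    using finL LX by (subst card_Un_disjoint[symmetric]) (auto intro!: arg_cong[where f = card])
  then have "card (Y \<inter> L) \<le> 2 \<or> card ((X - Y) \<inter> L) \<le> 2" using card by linarith
  then show ?thesis using *[of Y] *[of "X - Y"] Y by fastforce
qed

section \<open>The ratio 5/6 for one pair of bundles\<close>

lemma min_le_greedy_pos:
  fixes u :: "nat \<Rightarrow> real" and pos :: "nat \<Rightarrow> nat"
  assumes fin: "finite A" "finite B" and disj: "A \<inter> B = {}"
    and gt0: "\<And>g. g \<in> A \<union> B \<Longrightarrow> 0 < u g"
    and inj: "inj_on pos (A \<union> B)"
    and desc: "\<And>g h. g \<in> A \<union> B \<Longrightarrow> h \<in> A \<union> B \<Longrightarrow> pos g < pos h \<Longrightarrow> u h \<le> u g"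
    and greedy: "\<And>b. b \<in> B \<Longrightarrow>
      sum u {g \<in> B. pos g < pos b} \<le> sum u {g \<in> A. pos g < pos b}"
    and Y: "Y \<subseteq> A \<union> B"
  shows "5 / 6 * min (sum u Y) (sum u (A \<union> B - Y)) \<le> sum u A"
proof (cases "B = {}")
  case True
  have "sum u Y \<le> sum u A"
    by (rule sum_mono2) (use True Y fin gt0 in \<open>auto intro: less_imp_le\<close>)
  moreover have "0 \<le> sum u A" by (rule sum_nonneg) (use gt0 in \<open>auto intro: less_imp_le\<close>)
  ultimately show ?thesis by (auto simp: min_def)
next
  case False
  define X where "X = A \<union> B"
  obtain b where b: "b \<in> B" and b_last: "\<And>g. g \<in> B \<Longrightarrow> pos g \<le> pos b"
    using obtains_MAX[OF fin(2) False, of pos] Max_ge[of "pos ` B"] fin by (metis finite_imageI imageI)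
  \<comment> \<open>The bundles just before \<open>b\<close> is given away; \<open>s\<close> is what
    \<open>A\<close> gains afterwards. Since \<open>b\<close> is the last good of \<open>B\<close>,
    \<open>Bp\<close> is the rest of \<open>B\<close>.\<close>
  define Bp A' where "Bp = B - {b}" and "A' = {g \<in> A. pos g < pos b}"
  define s where "s = sum u (A - A')"
  have Bp_eq: "Bp = {g \<in> B. pos g < pos b}"
    using b b_last inj unfolding Bp_def inj_on_def by (force simp: le_less)
  have BpA': "sum u Bp \<le> sum u A'" using greedy[OF b] unfolding Bp_eq A'_def .
  have nonneg: "\<And>g. g \<in> X \<Longrightarrow> 0 \<le> u g" using gt0 X_def less_imp_le by blast
  have finX: "finite X" and finA': "finite A'" and finBp: "finite Bp"
    using fin unfolding X_def A'_def Bp_def by auto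
  have sumA: "sum u A = sum u A' + s"
    unfolding s_def by (subst sum.subset_diff[of A' A]) (use fin in \<open>auto simp: A'_def\<close>)
  have sumB: "sum u B = sum u Bp + u b"
    unfolding Bp_def using fin b by (simp add: sum_diff1)
  have s0: "0 \<le> s" unfolding s_def by (rule sum_nonneg) (use nonneg X_def in auto)
  have A'0: "0 \<le> sum u A'" by (rule sum_nonneg) (use nonneg X_def A'_def in auto)
  have total: "sum u Y + sum u (X - Y) = sum u A + sum u B"
    using sum.subset_diff[of Y X u] Y finX sum.union_disjoint[OF fin disj, of u]
    unfolding X_def by simp
  define L where "L = A' \<union> B"
  have LX: "L \<subseteq> X" unfolding L_def X_def A'_def by auto
  have XL: "sum u (X - L) = s"
    unfolding s_def X_def L_def by (rule arg_cong[where f = "sum u"]) (use disj in auto)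
  have big: "u b \<le> u g" if "g \<in> L" for g
  proof (cases "g = b")
    case False
    then have "pos g < pos b" "g \<in> A \<union> B"
      using that Bp_eq unfolding L_def A'_def Bp_def by blast+
    then show ?thesis using desc[of g b] b by blast
  qed simp
  have lowA': "real (card A') * u b \<le> sum u A'" and lowBp: "real (card Bp) * u b \<le> sum u Bp"
    by (rule sum_bounded_below, use big L_def Bp_def in auto)+
  have b0: "0 < u b" using gt0 b by auto
  have YX: "Y \<subseteq> X" using Y X_def by simp
  have goal: ?thesis if "min (sum u Y) (sum u (X - Y)) \<le> 6 / 5 * sum u A"
    using that unfolding X_def by simp
  have removed: ?thesis if "x \<in> L" "u x \<le> sum u A'" "sum u (L - {x}) - u b \<le> sum u A'" for x
  proof -
    have "min (sum u Y) (sum u (X - Y)) \<le> sum u A' + s"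
      using min_le_of_smallest_removed[OF finX nonneg LX YX that(1,2) big that(3)] XL by simp
    then show ?thesis using goal sumA s0 A'0 by simp
  qed
  have disjL: "A' \<inter> B = {}" using disj A'_def by auto
  \<comment> \<open>If \<open>b\<close> is small, averaging suffices. If \<open>Bp\<close> is empty,
    the side without \<open>b\<close> lies inside \<open>A\<close>. If \<open>Bp\<close> or
    \<open>A'\<close> is a single good, that good plays \<open>x\<close> in \<open>removed\<close>.
    What remains turns out to be the case of two goods in \<open>A'\<close> and three in
    \<open>B\<close>.\<close>
  consider "5 * u b \<le> 2 * sum u A" | "2 * sum u A < 5 * u b" "Bp = {}"
    | y where "Bp = {y}" | x where "A' = {x}"
    | "2 * sum u A < 5 * u b" "2 \<le> card Bp" "card A' = 0 \<or> 2 \<le> card A'"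
  proof -
    consider "card A' = 1" | "card Bp = 0" | "card Bp = 1"
      | "2 \<le> card Bp" "card A' = 0 \<or> 2 \<le> card A'"
      by linarith
    then show ?thesis
    proof cases
      case 1
      then show ?thesis using that(4) by (rule card_1_singletonE)
    next
      case 2
      then show ?thesis using that(1,2) finBp by fastforce
    next
      case 3
      then show ?thesis using that(3) by (rule card_1_singletonE)
    next
      case 4
      then show ?thesis using that(1,5) by (meson not_le)
    qed
  qed
  then show ?thesis
  proof cases
    case 1
    then show ?thesis using goal total BpA' sumA sumB s0 by linarith
  next
    case 2
    have "sum u Y \<le> sum u A \<or> sum u (X - Y) \<le> sum u A"
    proof (cases "b \<in> Y")
      case True
      have "sum u (X - Y) \<le> sum u A"
        by (rule sum_mono2) (use True 2 fin nonneg b in \<open>auto simp: X_def Bp_def\<close>)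
      then show ?thesis ..
    next
      case False
      have "sum u Y \<le> sum u A"
        by (rule sum_mono2) (use False 2 fin nonneg b YX in \<open>auto simp: X_def Bp_def\<close>)
      then show ?thesis ..
    qed
    then show ?thesis using goal sumA s0 A'0 by linarith
  next
    case (3 y)
    have "L - {y} = insert b A'" "b \<notin> A'" "y \<in> L"
      using 3 b disj unfolding L_def Bp_def A'_def by auto
    then show ?thesis using removed[of y] 3 BpA' finA' by simp
  next
    case (4 x)
    have "L - {x} = B" "x \<in> L" using 4 disjL unfolding L_def by auto
    then show ?thesis using removed[of x] 4 BpA' sumB by simp
  next
    case 5
    have "2 * u b \<le> real (card Bp) * u b" using 5 b0 by simp
    then have "2 * u b \<le> sum u Bp" using lowBp by linarith
    \<comment> \<open>Three goods worth at least \<open>u b\<close> would outweigh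
      \<open>sum u A\<close>, which is below \<open>5/2 * u b\<close>. This rules out a larger
      \<open>A'\<close> here and a larger \<open>Bp\<close> below.\<close>
    have cA: "card A' = 2"
    proof (rule ccontr)
      assume "card A' \<noteq> 2"
      then have "card A' = 0 \<or> 3 \<le> card A'" using 5 by linarith
      then show False
      proof
        assume "card A' = 0"
        then have "sum u A' = 0" using finA' by simp
        then show False using \<open>2 * u b \<le> sum u Bp\<close> BpA' b0 by linarith
      next
        assume "3 \<le> card A'"
        then have "3 * u b \<le> real (card A') * u b" using b0 by simp
        then show False using lowA' 5 sumA s0 b0 by linarith
      qed
    qed
    have cB: "card Bp = 2"
    proof (rule ccontr)
      assume "card Bp \<noteq> 2"
      then have "3 * u b \<le> real (card Bp) * u b" using 5 b0 by simp
      then show False using lowBp BpA' 5 sumA s0 b0 by linarith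
    qed
    have other: "u g + u b \<le> sum u S" if S: "finite S" "card S = 2" "S \<subseteq> L" "g \<in> S" for S g
    proof -
      have "card (S - {g}) = 1" using S by simp
      then obtain h where h: "S - {g} = {h}" by (auto simp: card_1_singleton_iff)
      have "sum u S = u g + sum u (S - {g})" using S by (simp add: sum.remove)
      then show ?thesis using h big[of h] S by auto
    qed
    \<comment> \<open>For \<open>g\<close> in \<open>A'\<close> or \<open>Bp\<close>, the other good
      of that bundle is worth at least \<open>u b\<close>, and neither bundle exceeds
      \<open>sum u A'\<close>.\<close>
    have c_le: "u g \<le> sum u A' - u b" if g: "g \<in> L" for g
    proof -
      consider "g \<in> A'" | "g \<in> Bp" | "g = b" using g unfolding L_def Bp_def by blast
      then show ?thesis
      proof cases
        case 1
        then show ?thesis using other[of A' g] finA' cA L_def by auto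
      next
        case 2
        moreover have "Bp \<subseteq> L" unfolding L_def Bp_def by blast
        ultimately show ?thesis using other[of Bp g] finBp cB BpA' by simp
      next
        case 3
        then show ?thesis using \<open>2 * u b \<le> sum u Bp\<close> BpA' by simp
      qed
    qed
    have card_L: "card L \<le> 5"
    proof -
      have "card B = 3" using cB b fin unfolding Bp_def by simp
      then show ?thesis using card_Un_le[of A' B] cA L_def by simp
    qed
    have c0: "0 \<le> sum u A' - u b" using \<open>2 * u b \<le> sum u Bp\<close> BpA' b0 by linarith
    have "min (sum u Y) (sum u (X - Y)) \<le> 2 * (sum u A' - u b) + s"
      unfolding XL[symmetric]
      by (rule min_le_of_five_large[OF finX _ LX YX card_L c0]) (simp_all add: nonneg c_le)
    \<comment> \<open>Since \<open>u b > 2/5 * sum u A\<close> and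
      \<open>sum u A = sum u A' + s\<close>, the left side is below
      \<open>6/5 * sum u A' + s/5\<close>.\<close>
    also have "\<dots> \<le> 6 / 5 * sum u A" using 5(1) sumA s0 by (simp add: field_simps)
    finally show ?thesis by (rule goal)
  qed
qed

text \<open>Goods worthless to \<open>u\<close> change no sum, so all sets are cut down to
  \<open>P\<close>. The hypotheses \<open>desc\<close> and \<open>greedy\<close> are restricted to
  goods that \<open>u\<close> values: zero values do not follow the order of assignment, and an
  unwanted good may go to a richer agent.\<close>

lemma min_le_greedy:
  fixes u :: "nat \<Rightarrow> real" and pos :: "nat \<Rightarrow> nat"
  assumes fin: "finite A" "finite B" and disj: "A \<inter> B = {}"
    and nonneg: "\<And>g. g \<in> A \<union> B \<Longrightarrow> 0 \<le> u g"
    and inj: "inj_on pos (A \<union> B)"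
    and desc: "\<And>g h. g \<in> A \<union> B \<Longrightarrow> h \<in> A \<union> B \<Longrightarrow> 0 < u g \<Longrightarrow> pos g < pos h \<Longrightarrow> u h \<le> u g"
    and greedy: "\<And>b. b \<in> B \<Longrightarrow> 0 < u b \<Longrightarrow>
      sum u {g \<in> B. pos g < pos b} \<le> sum u {g \<in> A. pos g < pos b}"
    and Y: "Y \<subseteq> A \<union> B"
  shows "5 / 6 * min (sum u Y) (sum u (A \<union> B - Y)) \<le> sum u A"
proof -
  define P where "P = {g. 0 < u g}"
  have sumP: "sum u (S \<inter> P) = sum u S" if "S \<subseteq> A \<union> B" for S
    by (rule sum.mono_neutral_left)
      (use that fin nonneg finite_subset[OF that] in \<open>fastforce simp: P_def less_le\<close>)+
  have "5 / 6 * min (sum u (Y \<inter> P)) (sum u ((A \<inter> P) \<union> (B \<inter> P) - (Y \<inter> P))) \<le> sum u (A \<inter> P)"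
  proof (rule min_le_greedy_pos[where pos = pos])
    show "inj_on pos (A \<inter> P \<union> B \<inter> P)" by (rule inj_on_subset[OF inj]) auto
    fix b assume b: "b \<in> B \<inter> P"
    have eq: "{g \<in> S \<inter> P. pos g < pos b} = {g \<in> S. pos g < pos b} \<inter> P" for S by auto
    show "sum u {g \<in> B \<inter> P. pos g < pos b} \<le> sum u {g \<in> A \<inter> P. pos g < pos b}"
      unfolding eq using b greedy[of b]
      by (subst (1 2) sumP) (auto simp: P_def)
  qed (use fin disj desc Y in \<open>auto simp: P_def\<close>)
  moreover have "(A \<inter> P) \<union> (B \<inter> P) - (Y \<inter> P) = (A \<union> B - Y) \<inter> P" by auto
  ultimately show ?thesis using Y by (simp add: sumP)
qed

section \<open>The greedy allocation\<close>

text \<open>Every ratio is at least the minimum 1, so the largest value of a good is at most its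
  smallest positive value.\<close>

lemma range_parameter_1_eq:
  assumes inst: "fair_division_instance n m v" and range: "range_parameter n m v = 1"
    and "i < n" "j < n" "g < m" "0 < v i g" "0 < v j g"
  shows "v i g = v j g"
proof -
  have le: "v i g \<le> v j g" if ij: "i < n" "j < n" "0 < v i g" "0 < v j g" for i j
  proof -
    have "{good_range n v g |g. g < m} = good_range n v ` {..<m}" by auto
    then have "1 \<le> good_range n v g"
      using range \<open>g < m\<close> Min_le[of "good_range n v ` {..<m}" "good_range n v g"]
      unfolding range_parameter_def by auto
    moreover have fin: "finite {v j g |j. j < n \<and> 0 < v j g}" "finite {v i g |i. i < n}" by auto
    have Mx: "v i g \<le> Max {v i g |i. i < n}" by (rule Max_ge[OF fin(2)]) (use ij in auto)
    have Mn: "Min {v j g |j. j < n \<and> 0 < v j g} \<le> v j g" by (rule Min_le[OF fin(1)]) (use ij in auto)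
    have "0 < Max {v i g |i. i < n}" using Mx ij by linarith
    ultimately have "Max {v i g |i. i < n} \<le> Min {v j g |j. j < n \<and> 0 < v j g}"
      unfolding good_range_def by (simp add: le_divide_eq)
    then show ?thesis using Mx Mn by linarith
  qed
  show ?thesis using assms le[of i j] le[of j i] by simp
qed

locale restricted_additive =
  fixes n m :: nat and v :: valuations
  assumes inst: "fair_division_instance n m v" and range: "range_parameter n m v = 1"
begin

lemma v_nonneg: "i < n \<Longrightarrow> g < m \<Longrightarrow> 0 \<le> v i g"
  using inst unfolding fair_division_instance_def by auto

text \<open>The range hypothesis enters the greedy argument in this form: agents who want
  \<open>g\<close> agree on its value, and the others value it at zero.\<close>

lemma v_le_positive:
  assumes "i < n" "j < n" "g < m" "0 < v j g" shows "v i g \<le> v j g"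
  using assms range_parameter_1_eq[OF inst range assms(1-3)] v_nonneg[of i g]
  by (cases "0 < v i g") auto

lemma n_m_pos: "0 < n" "0 < m"
  using inst unfolding fair_division_instance_def by (auto dest: spec[of _ 0])

section \<open>Candidate pairs and the greedy invariant\<close>

definition candidate :: "(nat \<Rightarrow> nat) \<Rightarrow> nat \<Rightarrow> nat \<Rightarrow> bool" where
  "candidate st i g \<longleftrightarrow> i < n \<and> g < m \<and> st g = 0 \<and> 0 < v i g"

text \<open>Lexicographic: value first, then load. Agents who want the same good agree on its value,
  so the tie-break picks the poorest of them.\<close>

definition preferred :: "(nat \<Rightarrow> real) \<Rightarrow> nat \<Rightarrow> nat \<Rightarrow> nat \<Rightarrow> nat \<Rightarrow> bool" where
  "preferred L i g i' g' \<longleftrightarrow> v i' g' < v i g \<or> v i' g' = v i g \<and> L i \<le> L i'"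

text \<open>
  The stamp \<open>st g\<close> is the number (from 1) of the round that assigned \<open>g\<close>, and 0 while \<open>g\<close>
  is unassigned.
\<close>

definition greedy_prefix ::
    "nat \<Rightarrow> (nat \<Rightarrow> nat) \<Rightarrow> (nat \<Rightarrow> nat) \<Rightarrow> (nat \<Rightarrow> real) \<Rightarrow> bool" where
  "greedy_prefix r own st L \<longleftrightarrow>
     (\<forall>g<m. st g \<le> r) \<and> card {g. g < m \<and> 0 < st g} = r \<and>
     (\<forall>g<m. \<forall>h<m. st g = st h \<longrightarrow> 0 < st g \<longrightarrow> g = h) \<and>
     (\<forall>g<m. 0 < st g \<longrightarrow> own g < n \<and> 0 < v (own g) g) \<and>
     (\<forall>i<n. L i = (\<Sum>g | g < m \<and> 0 < st g \<and> own g = i. v i g)) \<and>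
     (\<forall>g<m. \<forall>h<m. \<forall>i<n. 0 < st g \<longrightarrow> st h = 0 \<or> st g < st h \<longrightarrow> v i h \<le> v (own g) g) \<and>
     (\<forall>b<m. \<forall>i<n. 0 < st b \<longrightarrow> 0 < v i b \<longrightarrow>
        (\<Sum>g | g < m \<and> 0 < st g \<and> st g < st b \<and> own g = own b. v (own b) g) \<le>
        (\<Sum>g | g < m \<and> 0 < st g \<and> st g < st b \<and> own g = i. v i g))"

lemma greedy_prefix_value_le:
  assumes "greedy_prefix r own st L" "g < m" "h < m" "i < n" "0 < st g" "st h = 0 \<or> st g < st h"
  shows "v i h \<le> v (own g) g"
proof -
  have "\<forall>g<m. \<forall>h<m. \<forall>i<n. 0 < st g \<longrightarrow> st h = 0 \<or> st g < st h \<longrightarrow> v i h \<le> v (own g) g"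
    using assms(1) unfolding greedy_prefix_def by (elim conjE)
  then show ?thesis using assms(2-) by blast
qed

text \<open>Stamps make the loads at a past round recoverable: the sums run over goods stamped
  before \<open>b\<close>, so the comparison made then survives all later rounds.\<close>

lemma greedy_prefix_load_le:
  assumes "greedy_prefix r own st L" "b < m" "i < n" "0 < st b" "0 < v i b"
  shows "(\<Sum>g | g < m \<and> 0 < st g \<and> st g < st b \<and> own g = own b. v (own b) g) \<le>
    (\<Sum>g | g < m \<and> 0 < st g \<and> st g < st b \<and> own g = i. v i g)"
  using assms unfolding greedy_prefix_def by simp

lemma greedy_prefix_0: "greedy_prefix 0 own (\<lambda>_. 0) (\<lambda>_. 0)"
  unfolding greedy_prefix_def by simp

text \<open>The chosen pair has the largest value still available, which keeps the order by value.
  Its agent is the poorest who wants \<open>g\<close>, which gives the load comparison for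
  \<open>g\<close>; comparisons for older goods are untouched.\<close>

lemma greedy_prefix_Suc:
  assumes pre: "greedy_prefix r own st L" and c: "candidate st i g"
    and best: "\<And>i' g'. candidate st i' g' \<Longrightarrow> preferred L i g i' g'"
  shows "greedy_prefix (Suc r) (own(g := i)) (st(g := Suc r)) (L(i := L i + v i g))"
proof -
  let ?own = "own(g := i)" and ?st = "st(g := Suc r)"
  have i: "i < n" and g: "g < m" and stg: "st g = 0" and pos: "0 < v i g"
    using c unfolding candidate_def by auto
  have st_le: "st h \<le> r" if "h < m" for h using pre that unfolding greedy_prefix_def by simp
  have L: "L j = (\<Sum>h | h < m \<and> 0 < st h \<and> own h = j. v j h)" if "j < n" for j
    using pre that unfolding greedy_prefix_def by simp
  \<comment> \<open>An agent who is no candidate for \<open>h\<close> has no positive value for it,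
    hence less than \<open>v i g\<close>.\<close>
  have max: "v j h \<le> v i g" if "j < n" "h < m" "st h = 0" for j h
    using best[of j h] that pos unfolding candidate_def preferred_def by force
  \<comment> \<open>The new stamp exceeds all earlier ones, so \<open>g\<close> is in no older
    history, while its own history is everything assigned so far.\<close>
  have before: "{h. h < m \<and> 0 < ?st h \<and> ?st h < ?st b \<and> ?own h = j} =
      (if b = g then {h. h < m \<and> 0 < st h \<and> own h = j}
       else {h. h < m \<and> 0 < st h \<and> st h < st b \<and> own h = j})" if "b < m" for b j
    using st_le[OF that] st_le stg by (auto simp: less_Suc_eq_le)
  have "card {h. h < m \<and> 0 < ?st h} = Suc r"
  proof -
    have "{h. h < m \<and> 0 < ?st h} = insert g {h. h < m \<and> 0 < st h}" using g by auto
    then show ?thesis using pre stg unfolding greedy_prefix_def by simp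
  qed
  moreover have "(L(i := L i + v i g)) j = (\<Sum>h | h < m \<and> 0 < ?st h \<and> ?own h = j. v j h)"
    if "j < n" for j
  proof (cases "j = i")
    case True
    have "{h. h < m \<and> 0 < ?st h \<and> ?own h = j} = insert g {h. h < m \<and> 0 < st h \<and> own h = j}"
      using g True by auto
    then show ?thesis using True L[OF that] stg by simp
  next
    case False
    have "{h. h < m \<and> 0 < ?st h \<and> ?own h = j} = {h. h < m \<and> 0 < st h \<and> own h = j}"
      using stg False by auto
    then show ?thesis using False L[OF that] by simp
  qed
  moreover have "(\<Sum>h | h < m \<and> 0 < ?st h \<and> ?st h < ?st b \<and> ?own h = ?own b. v (?own b) h) \<le>
        (\<Sum>h | h < m \<and> 0 < ?st h \<and> ?st h < ?st b \<and> ?own h = j. v j h)"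
    if b: "b < m" "j < n" "0 < ?st b" "0 < v j b" for b j
  proof (cases "b = g")
    case True
    \<comment> \<open>\<open>j\<close> also wants \<open>g\<close>, so \<open>v j g\<close> cannot
      be below \<open>v i g\<close> and the preference must come from the loads.\<close>
    have "preferred L i g j g" using best[of j g] b True g stg unfolding candidate_def by auto
    then have "L i \<le> L j" using v_le_positive[of i j g] i b g True unfolding preferred_def by auto
    then show ?thesis unfolding before[OF b(1)] using True L i b by simp
  next
    case False
    then show ?thesis unfolding before[OF b(1)]
      using greedy_prefix_load_le[OF pre, of b j] b by simp
  qed
  moreover have "v j h \<le> v (?own g') g'"
    if "g' < m" "h < m" "j < n" "0 < ?st g'" "?st h = 0 \<or> ?st g' < ?st h" for g' h j
  proof (cases "g' = g")
    case True
    then show ?thesis using that max st_le[of h] by (auto split: if_splits)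
  next
    case False
    then have "st h = 0 \<or> st g' < st h" using that stg by (auto split: if_splits)
    then have "v j h \<le> v (own g') g'"
      using that False greedy_prefix_value_le[OF pre, of g' h j] by simp
    then show ?thesis using False by simp
  qed
  moreover have "g' = h" if "g' < m" "h < m" "?st g' = ?st h" "0 < ?st g'" for g' h
    using that st_le[of g'] st_le[of h] pre unfolding greedy_prefix_def
    by (auto split: if_splits)
  moreover have "?own h < n \<and> 0 < v (?own h) h" if "h < m" "0 < ?st h" for h
    using that pre i pos unfolding greedy_prefix_def by (auto split: if_splits)
  moreover have "?st h \<le> Suc r" if "h < m" for h using st_le[OF that] by simp
  ultimately show ?thesis unfolding greedy_prefix_def by blast
qed

lemma ex_candidate:
  assumes "greedy_prefix r own st L" "r < m"
  obtains i g where "candidate st i g"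
proof -
  have "{g. g < m \<and> 0 < st g} \<noteq> {..<m}"
    using assms unfolding greedy_prefix_def by auto
  then obtain g where "g < m" "st g = 0" by auto
  then show ?thesis
    using that inst unfolding candidate_def fair_division_instance_def by blast
qed

text \<open>After \<open>m\<close> rounds every good is stamped, so for each pair of agents the
  stamps serve as \<open>pos\<close> in \<open>min_le_greedy\<close>.\<close>

lemma greedy_prefix_final:
  assumes pre: "greedy_prefix m own st L" and A: "\<And>i. A i = {g. g < m \<and> own g = i}"
  shows "is_allocation n m A" and "is_PMMS (5 / 6) n v A"
proof -
  have st: "0 < st g" if "g < m" for g
  proof -
    have "{g. g < m \<and> 0 < st g} = {..<m}"
      by (rule card_subset_eq) (use pre in \<open>auto simp: greedy_prefix_def\<close>)
    then show ?thesis using that by auto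
  qed
  have own: "own g < n" "0 < v (own g) g" if "g < m" for g
    using pre st that unfolding greedy_prefix_def by auto
  show "is_allocation n m A" unfolding is_allocation_def A using own by auto
  show "is_PMMS (5 / 6) n v A" unfolding is_PMMS_def
  proof (intro allI impI)
    fix i j assume ij: "i < n" "j < n" "i \<noteq> j"
    have fin: "finite (A i)" "finite (A j)" unfolding A by auto
    have *: "5 / 6 * min (sum (v i) Y) (sum (v i) (A i \<union> A j - Y)) \<le> sum (v i) (A i)"
      if "Y \<subseteq> A i \<union> A j" for Y
    proof (rule min_le_greedy[where pos = st])
      show "inj_on st (A i \<union> A j)"
        using pre st unfolding greedy_prefix_def A inj_on_def by auto
      show "v i h \<le> v i g"
        if gh: "g \<in> A i \<union> A j" "h \<in> A i \<union> A j" "0 < v i g" "st g < st h" for g h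
      proof -
        have "g < m" "h < m" using gh A by auto
        then have "v i h \<le> v (own g) g" using greedy_prefix_value_le[OF pre] st ij gh by blast
        also have "\<dots> \<le> v i g" using v_le_positive own \<open>g < m\<close> ij gh by blast
        finally show ?thesis .
      qed
      show "sum (v i) {g \<in> A j. st g < st b} \<le> sum (v i) {g \<in> A i. st g < st b}"
        if b: "b \<in> A j" "0 < v i b" for b
      proof -
        have bm: "b < m" "own b = j" using b A by auto
        have eq: "{g \<in> A x. st g < st b} = {g. g < m \<and> 0 < st g \<and> st g < st b \<and> own g = x}" for x
          using st A by auto
        \<comment> \<open>An owner's value for a good is maximal, so agent \<open>i\<close> sees the
          bundle of \<open>j\<close> as worth no more than \<open>j\<close> does.\<close>
        have "sum (v i) {g \<in> A j. st g < st b} \<le> sum (v j) {g \<in> A j. st g < st b}"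
          by (rule sum_mono) (use v_le_positive own ij in \<open>auto simp: A\<close>)
        also have "\<dots> \<le> sum (v i) {g \<in> A i. st g < st b}"
          unfolding eq using greedy_prefix_load_le[OF pre, of b i] b bm st ij by simp
        finally show ?thesis .
      qed
    qed (use that fin ij v_nonneg in \<open>auto simp: A\<close>)
    let ?M = "{min (bundle_value v i Y) (bundle_value v i (A i \<union> A j - Y)) |Y. Y \<subseteq> A i \<union> A j}"
    have "?M = (\<lambda>Y. min (bundle_value v i Y) (bundle_value v i (A i \<union> A j - Y))) ` Pow (A i \<union> A j)"
      by auto
    \<comment> \<open>The maximum over finitely many partitions is attained, so the bound for each
      \<open>Y\<close> carries over.\<close>
    then have "maximin_share2 v i (A i \<union> A j) \<in> ?M"
      unfolding maximin_share2_def by (intro Max_in) (use fin in auto)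
    then show "5 / 6 * maximin_share2 v i (A i \<union> A j) \<le> bundle_value v i (A i)"
      using * unfolding bundle_value_def by auto
  qed
qed

end

section \<open>The program and its running time\<close>

primrec loop_free :: "com \<Rightarrow> bool" where
  "loop_free Skip \<longleftrightarrow> True"
| "loop_free (IAssign x a e) \<longleftrightarrow> True"
| "loop_free (RAssign x a e) \<longleftrightarrow> True"
| "loop_free (Seq c d) \<longleftrightarrow> loop_free c \<and> loop_free d"
| "loop_free (Cond b c d) \<longleftrightarrow> loop_free c \<and> loop_free d"
| "loop_free (While b c) \<longleftrightarrow> False"

text \<open>The values of \<open>run\<close> and \<open>max_time\<close> on loops are junk.\<close>

primrec run :: "com \<Rightarrow> state \<Rightarrow> state" where
  "run Skip s = s"
| "run (IAssign x a e) s = iwrite x (ival a s) (ival e s) s"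
| "run (RAssign x a e) s = rwrite x (ival a s) (rval e s) s"
| "run (Seq c d) s = run d (run c s)"
| "run (Cond b c d) s = (if bval b s then run c s else run d s)"
| "run (While b c) s = s"

primrec max_time :: "com \<Rightarrow> nat" where
  "max_time Skip = 1"
| "max_time (IAssign x a e) = 1"
| "max_time (RAssign x a e) = 1"
| "max_time (Seq c d) = max_time c + max_time d"
| "max_time (Cond b c d) = 1 + max (max_time c) (max_time d)"
| "max_time (While b c) = 0"

text \<open>Loop-free code is handled by rewriting with \<open>run\<close>, which leaves invariants
  to the loops. The time is only bounded because the branches of a conditional may differ in
  cost.\<close>

lemma exec_run:
  assumes "loop_free c" shows "\<exists>t\<le>max_time c. exec c s t (run c s)"
  using assms
proof (induction c arbitrary: s)
  case (Seq c d)
  obtain t where "t \<le> max_time c" "exec c s t (run c s)"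
    using Seq.IH(1)[of s] Seq.prems by auto
  moreover obtain t' where "t' \<le> max_time d" "exec d (run c s) t' (run d (run c s))"
    using Seq.IH(2)[of "run c s"] Seq.prems by auto
  ultimately have "exec (Seq c d) s (t + t') (run (Seq c d) s)" "t + t' \<le> max_time (Seq c d)"
    by (auto intro: exec.Seq)
  then show ?case by blast
next
  case (Cond b c d)
  show ?case
  proof (cases "bval b s")
    case True
    obtain t where t: "t \<le> max_time c" "exec c s t (run c s)"
      using Cond.IH(1)[of s] Cond.prems by auto
    then have "exec (Cond b c d) s (1 + t) (run (Cond b c d) s)" "1 + t \<le> max_time (Cond b c d)"
      using t(1) True exec.CondT[OF True t(2)] by simp_all
    then show ?thesis by blast
  next
    case False
    obtain t where t: "t \<le> max_time d" "exec d s t (run d s)"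
      using Cond.IH(2)[of s] Cond.prems by auto
    then have "exec (Cond b c d) s (1 + t) (run (Cond b c d) s)" "1 + t \<le> max_time (Cond b c d)"
      using t(1) False exec.CondF[OF False t(2)] by simp_all
    then show ?thesis by blast
  qed
next
  case Skip
  show ?case using exec.Skip by (intro exI[of _ 1]) simp
next
  case (IAssign x a e)
  show ?case using exec.IAssign by (intro exI[of _ 1]) simp
next
  case (RAssign x a e)
  show ?case using exec.RAssign by (intro exI[of _ 1]) simp
qed simp

text \<open>Induction on the number \<open>d\<close> of iterations left. Each costs one guard and at
  most \<open>T\<close>; the leading 1 pays for the final failing guard.\<close>

lemma exec_counted_loop:
  assumes step: "\<And>k s. k < N \<Longrightarrow> I k s \<Longrightarrow>
      bval b s \<and> (\<exists>t s'. exec c s t s' \<and> t \<le> T \<and> I (Suc k) s')"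
    and stop: "\<And>s. I N s \<Longrightarrow> \<not> bval b s"
    and init: "I 0 s"
  shows "\<exists>t s'. exec (While b c) s t s' \<and> t \<le> 1 + N * (1 + T) \<and> I N s'"
proof -
  have "\<exists>t s'. exec (While b c) s t s' \<and> t \<le> 1 + d * (1 + T) \<and> I N s'"
    if "d \<le> N" "I (N - d) s" for d s
    using that
  proof (induction d arbitrary: s)
    case 0
    then show ?case using stop exec.WhileF by fastforce
  next
    case (Suc d)
    then have lt: "N - Suc d < N" and Suc_eq: "Suc (N - Suc d) = N - d" by auto
    obtain t1 s1 where b: "bval b s" and 1: "exec c s t1 s1" "t1 \<le> T" "I (N - d) s1"
      using step[OF lt Suc.prems(2)] Suc_eq by auto
    obtain t2 s2 where 2: "exec (While b c) s1 t2 s2" "t2 \<le> 1 + d * (1 + T)" "I N s2"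
      using Suc.IH[OF _ 1(3)] Suc.prems by auto
    have "exec (While b c) s (1 + t1 + t2) s2" by (rule exec.WhileT[OF b 1(1) 2(1)])
    moreover have "1 + t1 + t2 \<le> 1 + Suc d * (1 + T)" using 1 2 by simp
    ultimately show ?case using 2 by blast
  qed
  from this[of N s] show ?thesis using init by simp
qed

section \<open>The greedy algorithm as a program\<close>

abbreviation ivar :: "string \<Rightarrow> iexp" where "ivar x \<equiv> ICell x (IConst 0)"
abbreviation rvar :: "string \<Rightarrow> rexp" where "rvar x \<equiv> RCell x (IConst 0)"
abbreviation iset :: "string \<Rightarrow> iexp \<Rightarrow> com" where "iset x e \<equiv> IAssign x (IConst 0) e"
abbreviation rset :: "string \<Rightarrow> rexp \<Rightarrow> com" where "rset x e \<equiv> RAssign x (IConst 0) e"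

text \<open>
  \<open>k\<close> runs through the entries of the valuation matrix and \<open>i\<close>, \<open>g\<close> are its row and
  column, maintained by counting because the machine cannot multiply or divide. Pairs
  \<open>(i, g)\<close> are compared by decreasing value and then by increasing load of \<open>i\<close>. A \<open>best\<close>
  value of 0 means that no candidate has been seen.
\<close>

definition better :: bexp where
  "better =
     BAnd (ILess (ICell ''stamp'' (ivar ''g'')) (IConst 1))
    (BAnd (RLess (RConst 0) (RCell ''v'' (ivar ''k'')))
    (BNot (BAnd (BNot (RLess (rvar ''best'') (RCell ''v'' (ivar ''k''))))
       (BNot (BAnd (BNot (RLess (RCell ''v'' (ivar ''k'')) (rvar ''best'')))
          (RLess (RCell ''load'' (ivar ''i'')) (RCell ''load'' (ivar ''bi''))))))))"

definition scan_body :: com where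
  "scan_body =
     Seq (Cond better
           (Seq (iset ''bi'' (ivar ''i''))
           (Seq (iset ''bg'' (ivar ''g''))
                (rset ''best'' (RCell ''v'' (ivar ''k'')))))
           Skip)
    (Seq (iset ''k'' (IAdd (ivar ''k'') (IConst 1)))
    (Seq (iset ''g'' (IAdd (ivar ''g'') (IConst 1)))
         (Cond (ILess (ivar ''g'') (ivar ''m''))
           Skip
           (Seq (iset ''g'' (IConst 0)) (iset ''i'' (IAdd (ivar ''i'') (IConst 1)))))))"

text \<open>\<open>bi\<close> and \<open>bg\<close> may hold stale indices: every candidate has
  positive value, so the first one found beats the \<open>best\<close> value 0 and overwrites
  them.\<close>

definition scan_init :: com where
  "scan_init =
     Seq (iset ''i'' (IConst 0)) (Seq (iset ''g'' (IConst 0))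
    (Seq (iset ''k'' (IConst 0)) (rset ''best'' (RConst 0))))"

definition scan :: com where
  "scan = While (ILess (ivar ''i'') (ivar ''n'')) scan_body"

text \<open>\<open>r\<close> is increased first, so stamps start at 1 and 0 keeps meaning
  unassigned.\<close>

definition assign :: com where
  "assign =
     Seq (iset ''r'' (IAdd (ivar ''r'') (IConst 1)))
    (Seq (IAssign ''owner'' (ivar ''bg'') (ivar ''bi''))
    (Seq (IAssign ''stamp'' (ivar ''bg'') (ivar ''r''))
         (RAssign ''load'' (ivar ''bi'')
            (RAdd (RCell ''load'' (ivar ''bi'')) (rvar ''best'')))))"

definition greedy_program :: com where
  "greedy_program =
     While (ILess (ivar ''r'') (ivar ''m'')) (Seq scan_init (Seq scan assign))"

lemma imem_iwrite [simp]:
  "imem (iwrite x k y s) = (imem s)(x := (imem s x)(k := y))"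
  "rmem (iwrite x k y s) = rmem s"
  by (simp_all add: iwrite_def)

lemma rmem_rwrite [simp]:
  "rmem (rwrite x k y s) = (rmem s)(x := (rmem s x)(k := y))"
  "imem (rwrite x k y s) = imem s"
  by (simp_all add: rwrite_def)

section \<open>Correctness and step count of the program\<close>

context restricted_additive
begin

definition input_cells :: "state \<Rightarrow> bool" where
  "input_cells s \<longleftrightarrow> imem s ''n'' 0 = n \<and> imem s ''m'' 0 = m \<and>
     (\<forall>k<n * m. rmem s ''v'' k = v (k div m) (k mod m))"

definition round_cells ::
    "nat \<Rightarrow> (nat \<Rightarrow> nat) \<Rightarrow> (nat \<Rightarrow> nat) \<Rightarrow> (nat \<Rightarrow> real) \<Rightarrow> state \<Rightarrow> bool" where
  "round_cells r own st L s \<longleftrightarrow> input_cells s \<and> imem s ''r'' 0 = r \<and>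
     imem s ''owner'' = own \<and> imem s ''stamp'' = st \<and> rmem s ''load'' = L"

text \<open>The flat index \<open>k'\<close> stands for the pair
  \<open>(k' div m, k' mod m)\<close>. The marker 0 is unambiguous because candidates have positive
  value.\<close>

definition best_candidate ::
    "(nat \<Rightarrow> nat) \<Rightarrow> (nat \<Rightarrow> real) \<Rightarrow> nat \<Rightarrow> nat \<Rightarrow> nat \<Rightarrow> real \<Rightarrow> bool" where
  "best_candidate st L k i g x \<longleftrightarrow>
     x = 0 \<and> (\<forall>k'<k. \<not> candidate st (k' div m) (k' mod m)) \<or>
     candidate st i g \<and> x = v i g \<and>
       (\<forall>k'<k. candidate st (k' div m) (k' mod m) \<longrightarrow> preferred L i g (k' div m) (k' mod m))"

definition scan_inv ::
    "nat \<Rightarrow> (nat \<Rightarrow> nat) \<Rightarrow> (nat \<Rightarrow> nat) \<Rightarrow> (nat \<Rightarrow> real) \<Rightarrow> nat \<Rightarrow> state \<Rightarrow> bool" where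
  "scan_inv r own st L k s \<longleftrightarrow> round_cells r own st L s \<and>
     imem s ''k'' 0 = k \<and> imem s ''i'' 0 = k div m \<and> imem s ''g'' 0 = k mod m \<and>
     best_candidate st L k (imem s ''bi'' 0) (imem s ''bg'' 0) (rmem s ''best'' 0)"

text \<open>The test is strict improvement in the order of \<open>preferred\<close>. That order is
  total and transitive, so the winner of each comparison beats everything seen before.\<close>

lemma best_candidate_Suc:
  assumes best: "best_candidate st L k i g x" and k: "k < n * m"
    and i': "i' = k div m" and g': "g' = k mod m"
  shows "if st g' < 1 \<and> 0 < v i' g' \<and> (x < v i' g' \<or> \<not> v i' g' < x \<and> L i' < L i)
    then best_candidate st L (Suc k) i' g' (v i' g')
    else best_candidate st L (Suc k) i g x"
proof -
  have i'g': "i' < n" "g' < m"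
    using k n_m_pos i' g' by (auto simp: less_mult_imp_div_less)
  have cand: "candidate st i' g' \<longleftrightarrow> st g' < 1 \<and> 0 < v i' g'"
    using i'g' by (auto simp: candidate_def)
  have trans: "preferred L i' g' j h"
    if "preferred L i g j h" "v i g < v i' g' \<or> \<not> v i' g' < v i g \<and> L i' < L i" for j h
    using that unfolding preferred_def by auto
  show ?thesis
  proof (cases "candidate st i' g'")
    case False
    then show ?thesis using best i' g' cand unfolding best_candidate_def
      by (auto simp: less_Suc_eq)
  next
    case True
    show ?thesis
    proof (cases "x < v i' g' \<or> \<not> v i' g' < x \<and> L i' < L i")
      case better: True
      have refl: "preferred L i' g' i' g'" unfolding preferred_def by simp
      have "best_candidate st L (Suc k) i' g' (v i' g')"
        using best unfolding best_candidate_def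
        by (elim disjE) (use True better i' g' refl trans in \<open>auto simp: less_Suc_eq\<close>)
      then show ?thesis using better True cand by simp
    next
      case worse: False
      \<comment> \<open>Positivity excludes the marker \<open>x = 0\<close>, against which any
        candidate would be an improvement.\<close>
      have "0 < v i' g'" using True cand by simp
      then have "best_candidate st L (Suc k) i g x"
        using best unfolding best_candidate_def
        by (elim disjE) (use True worse i' g' in \<open>auto simp: less_Suc_eq preferred_def\<close>)
      then show ?thesis using worse by auto
    qed
  qed
qed

lemma scan_step:
  assumes inv: "scan_inv r own st L k s" and k: "k < n * m"
  shows "scan_inv r own st L (Suc k) (run scan_body s)"
proof -
  have cells: "imem s ''n'' 0 = n" "imem s ''m'' 0 = m" "imem s ''r'' 0 = r"
      "imem s ''owner'' = own" "imem s ''stamp'' = st" "rmem s ''load'' = L"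
      "\<forall>k<n * m. rmem s ''v'' k = v (k div m) (k mod m)"
      "imem s ''k'' 0 = k" "imem s ''i'' 0 = k div m" "imem s ''g'' 0 = k mod m"
    and best: "best_candidate st L k (imem s ''bi'' 0) (imem s ''bg'' 0) (rmem s ''best'' 0)"
    using inv unfolding scan_inv_def round_cells_def input_cells_def by auto
  have vk: "rmem s ''v'' k = v (k div m) (k mod m)" using cells k by blast
  \<comment> \<open>The column counter wraps at the end of a row, and the row counter then
    advances.\<close>
  have next_pos: "Suc (k mod m) < m \<Longrightarrow> Suc k div m = k div m \<and> Suc k mod m = Suc (k mod m)"
    "\<not> Suc (k mod m) < m \<Longrightarrow> Suc k div m = Suc (k div m) \<and> Suc k mod m = 0"
    using n_m_pos mod_less_divisor[OF n_m_pos(2), of k] by (auto simp: div_Suc mod_Suc)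
  \<comment> \<open>\<open>bexp\<close> has no disjunction, so \<open>better\<close> expresses it by
    De Morgan.\<close>
  have better: "bval better s \<longleftrightarrow> st (k mod m) < 1 \<and> 0 < v (k div m) (k mod m) \<and>
      (rmem s ''best'' 0 < v (k div m) (k mod m) \<or>
       \<not> v (k div m) (k mod m) < rmem s ''best'' 0 \<and> L (k div m) < L (imem s ''bi'' 0))"
    unfolding better_def by (auto simp: cells vk)
  have best': "if bval better s
      then best_candidate st L (Suc k) (k div m) (k mod m) (v (k div m) (k mod m))
      else best_candidate st L (Suc k) (imem s ''bi'' 0) (imem s ''bg'' 0) (rmem s ''best'' 0)"
    using best_candidate_Suc[OF best k refl refl] unfolding better .
  define s1 where "s1 = (if bval better s
    then rwrite ''best'' 0 (v (k div m) (k mod m))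
      (iwrite ''bg'' 0 (k mod m) (iwrite ''bi'' 0 (k div m) s)) else s)"
  have round1: "round_cells r own st L s1"
    using inv unfolding s1_def scan_inv_def round_cells_def input_cells_def by simp
  have cells1: "imem s1 ''k'' 0 = k" "imem s1 ''i'' 0 = k div m" "imem s1 ''g'' 0 = k mod m"
      "imem s1 ''m'' 0 = m"
    using cells unfolding s1_def by simp_all
  have best1: "best_candidate st L (Suc k) (imem s1 ''bi'' 0) (imem s1 ''bg'' 0) (rmem s1 ''best'' 0)"
    using best' unfolding s1_def by (simp split: if_splits)
  define s2 where "s2 = iwrite ''g'' 0 (Suc (k mod m)) (iwrite ''k'' 0 (Suc k) s1)"
  have "run scan_body s = (if Suc (k mod m) < m then s2
      else iwrite ''i'' 0 (Suc (k div m)) (iwrite ''g'' 0 0 s2))"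
  proof -
    have "run scan_body s = run (Cond (ILess (ivar ''g'') (ivar ''m'')) Skip
        (Seq (iset ''g'' (IConst 0)) (iset ''i'' (IAdd (ivar ''i'') (IConst 1))))) s2"
      unfolding scan_body_def s2_def by (simp add: s1_def cells vk)
    also have "\<dots> = (if Suc (k mod m) < m then s2
        else iwrite ''i'' 0 (Suc (k div m)) (iwrite ''g'' 0 0 s2))"
      by (simp add: s2_def cells1)
    finally show ?thesis .
  qed
  moreover have "scan_inv r own st L (Suc k) s2" if "Suc (k mod m) < m"
    using next_pos(1)[OF that] round1 cells1 best1
    unfolding scan_inv_def round_cells_def input_cells_def s2_def by simp
  moreover have "scan_inv r own st L (Suc k)
      (iwrite ''i'' 0 (Suc (k div m)) (iwrite ''g'' 0 0 s2))" if "\<not> Suc (k mod m) < m"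
    using next_pos(2)[OF that] round1 cells1 best1
    unfolding scan_inv_def round_cells_def input_cells_def s2_def by simp
  ultimately show ?thesis by simp
qed

text \<open>The guard only looks at the row, and \<open>k div m < n\<close> holds exactly while
  \<open>k < n * m\<close>.\<close>

lemma exec_scan:
  assumes "scan_inv r own st L 0 s"
  shows "\<exists>t s'. exec scan s t s' \<and> t \<le> 1 + n * m * (1 + max_time scan_body) \<and>
    scan_inv r own st L (n * m) s'"
  unfolding scan_def
proof (rule exec_counted_loop[where I = "scan_inv r own st L"])
  fix k s assume k: "k < n * m" and inv: "scan_inv r own st L k s"
  have "k div m < n" using k by (simp add: less_mult_imp_div_less)
  then have "bval (ILess (ivar ''i'') (ivar ''n'')) s"
    using inv unfolding scan_inv_def round_cells_def input_cells_def by simp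
  moreover have "loop_free scan_body" by (simp add: scan_body_def)
  ultimately show "bval (ILess (ivar ''i'') (ivar ''n'')) s \<and>
      (\<exists>t s'. exec scan_body s t s' \<and> t \<le> max_time scan_body \<and> scan_inv r own st L (Suc k) s')"
    using exec_run[of scan_body s] scan_step[OF inv k] by blast
next
  fix s assume "scan_inv r own st L (n * m) s"
  then show "\<not> bval (ILess (ivar ''i'') (ivar ''n'')) s"
    using n_m_pos unfolding scan_inv_def round_cells_def input_cells_def by simp
qed (rule assms)

definition round_inv :: "nat \<Rightarrow> state \<Rightarrow> bool" where
  "round_inv r s \<longleftrightarrow> (\<exists>own st L. round_cells r own st L s \<and> greedy_prefix r own st L)"

text \<open>A candidate exists because \<open>r < m\<close>, so the scan ends with a genuine pair,
  and this pair is optimal among all candidates.\<close>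

lemma exec_round:
  assumes inv: "round_inv r s" and r: "r < m"
  shows "\<exists>t s'. exec (Seq scan_init (Seq scan assign)) s t s' \<and>
    t \<le> max_time scan_init + (1 + n * m * (1 + max_time scan_body) + max_time assign) \<and>
    round_inv (Suc r) s'"
proof -
  obtain own st L where cells: "round_cells r own st L s" and pre: "greedy_prefix r own st L"
    using inv unfolding round_inv_def by auto
  obtain t1 where t1: "t1 \<le> max_time scan_init" "exec scan_init s t1 (run scan_init s)"
    using exec_run[of scan_init s] by (auto simp: scan_init_def)
  have "scan_inv r own st L 0 (run scan_init s)"
    using cells unfolding scan_inv_def round_cells_def input_cells_def scan_init_def
    by (simp add: best_candidate_def)
  then obtain t2 s2 where s2: "exec scan (run scan_init s) t2 s2"
      "t2 \<le> 1 + n * m * (1 + max_time scan_body)" "scan_inv r own st L (n * m) s2"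
    using exec_scan by blast
  obtain t3 where t3: "t3 \<le> max_time assign" "exec assign s2 t3 (run assign s2)"
    using exec_run[of assign s2] by (auto simp: assign_def)
  define i g where "i = imem s2 ''bi'' 0" and "g = imem s2 ''bg'' 0"
  \<comment> \<open>Every candidate pair is visited, namely at the flat index
    \<open>j * m + h\<close>.\<close>
  have flat: "(j * m + h) div m = j \<and> (j * m + h) mod m = h \<and> j * m + h < n * m"
    if "candidate st j h" for j h
  proof -
    have jh: "j < n" "h < m" using that unfolding candidate_def by auto
    then have "j * m + h < Suc j * m" by simp
    also have "\<dots> \<le> n * m" using jh by (intro mult_right_mono) auto
    finally show ?thesis using jh by simp
  qed
  obtain j h where "candidate st j h" using ex_candidate[OF pre r] .
  then have ex: "\<not> (\<forall>k'<n * m. \<not> candidate st (k' div m) (k' mod m))" using flat by metis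
  then have c: "candidate st i g" and x: "rmem s2 ''best'' 0 = v i g"
    and all: "\<forall>k'<n * m. candidate st (k' div m) (k' mod m) \<longrightarrow>
      preferred L i g (k' div m) (k' mod m)"
    using s2(3) unfolding scan_inv_def best_candidate_def i_def g_def by auto
  have "preferred L i g j h" if "candidate st j h" for j h
    using all flat[OF that] that by metis
  then have pre': "greedy_prefix (Suc r) (own(g := i)) (st(g := Suc r)) (L(i := L i + v i g))"
    using greedy_prefix_Suc[OF pre c] by blast
  have "round_cells (Suc r) (own(g := i)) (st(g := Suc r)) (L(i := L i + v i g)) (run assign s2)"
    using s2(3) x unfolding scan_inv_def round_cells_def input_cells_def assign_def i_def g_def
    by simp
  then have "round_inv (Suc r) (run assign s2)" using pre' unfolding round_inv_def by blast
  moreover have "exec (Seq scan_init (Seq scan assign)) s (t1 + (t2 + t3)) (run assign s2)"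
    using t1 s2 t3 by (auto intro: exec.Seq)
  moreover have "t1 + (t2 + t3) \<le>
      max_time scan_init + (1 + n * m * (1 + max_time scan_body) + max_time assign)"
    using t1 s2 t3 by linarith
  ultimately show ?thesis by blast
qed

lemma exec_greedy_program:
  "\<exists>t s. exec greedy_program (input_state n m v) t s \<and>
    t \<le> 1 + m * (1 + (max_time scan_init + (1 + n * m * (1 + max_time scan_body) + max_time assign))) \<and>
    round_inv m s"
  unfolding greedy_program_def
proof (rule exec_counted_loop[where I = round_inv])
  fix r s assume "r < m" "round_inv r s"
  then show "bval (ILess (ivar ''r'') (ivar ''m'')) s \<and>
      (\<exists>t s'. exec (Seq scan_init (Seq scan assign)) s t s' \<and>
        t \<le> max_time scan_init + (1 + n * m * (1 + max_time scan_body) + max_time assign) \<and>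
        round_inv (Suc r) s')"
    using exec_round[of r s] by (auto simp: round_inv_def round_cells_def input_cells_def)
next
  fix s assume "round_inv m s"
  then show "\<not> bval (ILess (ivar ''r'') (ivar ''m'')) s"
    by (auto simp: round_inv_def round_cells_def input_cells_def)
next
  \<comment> \<open>All cells outside the instance start at 0, which already encodes the empty
    allocation.\<close>
  have "round_cells 0 (\<lambda>_. 0) (\<lambda>_. 0) (\<lambda>_. 0) (input_state n m v)"
    unfolding round_cells_def input_cells_def input_state_def by simp
  then show "round_inv 0 (input_state n m v)"
    using greedy_prefix_0 unfolding round_inv_def by blast
qed

end

section \<open>A polynomial time bound\<close>

lemma cubic_time_bound:
  fixes n m a b c :: nat
  shows "1 + m * (1 + (a + (1 + n * m * (1 + b) + c))) \<le> (3 + a + b + c) * (1 + (n + m)) ^ 3"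
proof -
  define x where "x = 1 + (n + m)"
  have x: "1 \<le> x * x" "n * m \<le> x * x" "1 + m \<le> x"
    unfolding x_def by (simp, rule mult_mono, simp_all)
  have "1 + (a + (1 + n * m * (1 + b) + c))
      \<le> x * x + (a * (x * x) + (x * x + x * x * (1 + b) + c * (x * x)))"
    by (intro add_mono mult_right_mono) (use x in auto)
  also have "\<dots> = (3 + a + b + c) * (x * x)" by (simp add: algebra_simps)
  finally have 1: "1 + (a + (1 + n * m * (1 + b) + c)) \<le> (3 + a + b + c) * (x * x)" .
  \<comment> \<open>The leading 1 is raised to one more copy of the bound for a round; this gives
    \<open>1 + m\<close> copies, and \<open>1 + m \<le> x\<close>.\<close>
  then have "1 \<le> (3 + a + b + c) * (x * x)" by (rule order_trans[rotated]) simp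
  then have "1 + m * (1 + (a + (1 + n * m * (1 + b) + c)))
      \<le> (3 + a + b + c) * (x * x) + m * ((3 + a + b + c) * (x * x))"
    by (rule add_mono) (rule mult_le_mono2[OF 1])
  also have "\<dots> = (1 + m) * ((3 + a + b + c) * (x * x))" by simp
  also have "\<dots> \<le> x * ((3 + a + b + c) * (x * x))" by (rule mult_right_mono) (use x in auto)
  also have "\<dots> = (3 + a + b + c) * x ^ 3" by (simp add: power3_eq_cube)
  finally show ?thesis unfolding x_def .
qed

theorem theorem5:
  shows "\<exists>(c :: com) (p :: nat poly).
           \<forall>(n :: nat) (m :: nat) (v :: valuations).
             fair_division_instance n m v \<and> range_parameter n m v = 1 \<longrightarrow>
             (\<exists>t s. exec c (input_state n m v) t s \<and>
                    t \<le> poly p (n + m) \<and>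
                    is_allocation n m (output_allocation m s) \<and>
                    is_PMMS (5 / 6) n v (output_allocation m s))"
proof -
  \<comment> \<open>\<open>K\<close> depends on the program alone, so \<open>p\<close>, which is
    \<open>K\<close> times the cube of one plus the variable, is uniform in the instance.\<close>
  define K where "K = 3 + max_time scan_init + max_time scan_body + max_time assign"
  define p where "p = [:K:] * [:1, 1:] ^ 3"
  have "\<exists>t s. exec greedy_program (input_state n m v) t s \<and> t \<le> poly p (n + m) \<and>
      is_allocation n m (output_allocation m s) \<and> is_PMMS (5 / 6) n v (output_allocation m s)"
    if "fair_division_instance n m v" "range_parameter n m v = 1" for n m v
  proof -
    interpret restricted_additive n m v using that by unfold_locales
    obtain t s where ts: "exec greedy_program (input_state n m v) t s"
      "t \<le> 1 + m * (1 + (max_time scan_init + (1 + n * m * (1 + max_time scan_body) + max_time assign)))"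
      "round_inv m s" using exec_greedy_program by blast
    obtain own st L where "round_cells m own st L s" and pre: "greedy_prefix m own st L"
      using ts unfolding round_inv_def by auto
    then have "output_allocation m s i = {g. g < m \<and> own g = i}" for i
      unfolding output_allocation_def round_cells_def by simp
    note final = greedy_prefix_final[OF pre this]
    note ts(2)
    also have "1 + m * (1 + (max_time scan_init +
        (1 + n * m * (1 + max_time scan_body) + max_time assign))) \<le> K * (1 + (n + m)) ^ 3"
      unfolding K_def by (rule cubic_time_bound)
    also have "\<dots> = poly p (n + m)" unfolding p_def by simp
    finally show ?thesis using ts(1) final by blast
  qed
  then show ?thesis by blast
qed

end
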